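(* Let $\mathrm D := A_1 - BK_0C$ and $L := A_r - BK_1C$. Suppose that the coefficients satisfy: $\alpha\in C([0,T])\cap C^1((0,T])$, $\beta\in C^1((0,T])$, $\alpha(t)>0$ and $\beta(t)>0$ for $t\in(0,T]$, $\alpha(0)=0$, there are constants $0<d_-\le d_+<\infty$ with $d_-\le d(t):=\beta(t)/\alpha(t)\le d_+$ for all $t\in(0,T]$, and $\int_0^\delta \frac{dt}{\alpha(t)}=+\infty$ for every $\delta\in(0,T]$. Assume that there exists a dense subspace $\mathcal D\subset X$ such that, for every $z_0\in\mathcal D$, the equation $$\dot z + d(t)A_0z + \frac{1}{\alpha(t)}\mathrm D z + Lz = 0$$ on $(0,T)$ admits a solution $z\in W^{1,1}(0,T;X)$ satisfying $z(t)\in D(A_0)$ for almost every $t\in(0,T)$, $A_0z\in L^1(0,T;X)$, and $z(0)=z_0$. Then $\mathrm D=0$; equivalently, $A_1=BK_0C$.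
   Context: $X$ is a Hilbert space, $T>0$, and $m,p$ are positive integers. $A_0:D(A_0)\subset X\to X$ is a linear operator; $A_1,A_r\in\mathcal L(X)$; $B\in\mathcal L(\mathbb R^m,X)$; $C\in\mathcal L(X,\mathbb R^p)$; $K_0,K_1\in\mathbb R^{m\times p}$ are constant gain matrices. $\mathcal L(\cdot,\cdot)$ denotes bounded linear operators. The equation is understood to hold for almost every $t\in(0,T)$. *)

theory Defs
  imports "HOL-Analysis.Analysis"
begin

text \<open>
  The library's \<open>integrable\<close> and \<open>has_bochner_integral\<close> require a second countable codomain, but \<open>X\<close> need not be separable.
  The definitions below replace Borel measurability by strong measurability; for second
  countable codomains and Borel measurable functions they agree with the library
  (\<open>strongly_integrable_iff_integrable\<close>, \<open>has_strong_integral_iff_has_bochner_integral\<close>).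
\<close>

definition strongly_measurable :: "'a measure \<Rightarrow> ('a \<Rightarrow> 'b::real_normed_vector) \<Rightarrow> bool" where
  "strongly_measurable M f \<longleftrightarrow>
     (\<exists>s. (\<forall>i::nat. simple_function M (s i)) \<and> (AE x in M. (\<lambda>i. s i x) \<longlonglongrightarrow> f x))"

definition strongly_integrable :: "'a measure \<Rightarrow> ('a \<Rightarrow> 'b::real_normed_vector) \<Rightarrow> bool" where
  "strongly_integrable M f \<longleftrightarrow>
     strongly_measurable M f \<and> (\<integral>\<^sup>+x. ennreal (norm (f x)) \<partial>M) < \<infinity>"

definition has_strong_integral ::
  "'a measure \<Rightarrow> ('a \<Rightarrow> 'b::real_normed_vector) \<Rightarrow> 'b \<Rightarrow> bool" where
  "has_strong_integral M f I \<longleftrightarrow>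
     strongly_measurable M f \<and>
     (\<exists>s. (\<forall>i::nat. Bochner_Integration.simple_bochner_integrable M (s i)) \<and>
          (\<lambda>i. \<integral>\<^sup>+x. ennreal (norm (f x - s i x)) \<partial>M) \<longlonglongrightarrow> 0 \<and>
          (\<lambda>i. Bochner_Integration.simple_bochner_integral M (s i)) \<longlonglongrightarrow> I)"

lemma borel_measurable_imp_strongly_measurable:
  fixes f :: "'a \<Rightarrow> 'b::{real_normed_vector, second_countable_topology}"
  assumes "f \<in> borel_measurable M"
  shows "strongly_measurable M f"
proof -
  obtain s where "\<And>i. simple_function M (s i)"
    and "\<And>x. x \<in> space M \<Longrightarrow> (\<lambda>i. s i x) \<longlonglongrightarrow> f x"
    using borel_measurable_implies_sequence_metric[OF assms, of 0] by blast
  then show ?thesis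
    unfolding strongly_measurable_def by (intro exI[of _ s]) auto
qed

lemma strongly_integrable_iff_integrable:
  fixes f :: "'a \<Rightarrow> 'b::{banach, second_countable_topology}"
  assumes "f \<in> borel_measurable M"
  shows "strongly_integrable M f \<longleftrightarrow> integrable M f"
  using assms borel_measurable_imp_strongly_measurable[OF assms]
  by (simp add: strongly_integrable_def integrable_iff_bounded)

lemma has_strong_integral_iff_has_bochner_integral:
  fixes f :: "'a \<Rightarrow> 'b::{real_normed_vector, second_countable_topology}"
  assumes "f \<in> borel_measurable M"
  shows "has_strong_integral M f I \<longleftrightarrow> has_bochner_integral M f I"
  using assms borel_measurable_imp_strongly_measurable[OF assms]
  by (auto simp: has_strong_integral_def has_bochner_integral.simps)

definition L1 :: "real \<Rightarrow> (real \<Rightarrow> 'x::real_normed_vector) \<Rightarrow> bool" where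
  "L1 T f \<longleftrightarrow> strongly_integrable (lebesgue_on {0<..<T}) f"

definition test_function :: "real \<Rightarrow> (real \<Rightarrow> real) \<Rightarrow> bool" where
  "test_function T \<phi> \<longleftrightarrow>
     (\<forall>n t. ((deriv ^^ n) \<phi>) field_differentiable (at t)) \<and>
     (\<exists>K. compact K \<and> K \<subseteq> {0<..<T} \<and> (\<forall>t. t \<notin> K \<longrightarrow> \<phi> t = 0))"

definition weak_derivative ::
  "real \<Rightarrow> (real \<Rightarrow> 'x::real_normed_vector) \<Rightarrow> (real \<Rightarrow> 'x) \<Rightarrow> bool" where
  "weak_derivative T z v \<longleftrightarrow>
     (\<forall>\<phi>. test_function T \<phi> \<longrightarrow>
        (\<exists>I. has_strong_integral (lebesgue_on {0<..<T}) (\<lambda>t. deriv \<phi> t *\<^sub>R z t) (- I) \<and>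
             has_strong_integral (lebesgue_on {0<..<T}) (\<lambda>t. \<phi> t *\<^sub>R v t) I))"

text \<open>\<open>W11 T z v\<close>: the function \<open>z\<close> lies in \<open>W\<^sup>1\<^sup>,\<^sup>1(0,T;X)\<close>, with weak derivative \<open>v\<close>.\<close>

definition W11 :: "real \<Rightarrow> (real \<Rightarrow> 'x::real_normed_vector) \<Rightarrow> (real \<Rightarrow> 'x) \<Rightarrow> bool" where
  "W11 T z v \<longleftrightarrow> L1 T z \<and> L1 T v \<and> weak_derivative T z v"

text \<open>
  Elements of \<open>W\<^sup>1\<^sup>,\<^sup>1(0,T;X)\<close> are only determined almost everywhere;
  \<open>z(0)\<close> is the value at \<open>0\<close> of the continuous representative.
\<close>

definition initial_value ::
  "real \<Rightarrow> (real \<Rightarrow> 'x::real_normed_vector) \<Rightarrow> 'x \<Rightarrow> bool" where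
  "initial_value T z z0 \<longleftrightarrow>
     (\<exists>w. continuous_on {0..T} w \<and> (AE t in lebesgue_on {0<..<T}. w t = z t) \<and> w 0 = z0)"

definition linear_operator :: "'x::real_vector set \<Rightarrow> ('x \<Rightarrow> 'x) \<Rightarrow> bool" where
  "linear_operator DA A \<longleftrightarrow>
     subspace DA \<and>
     (\<forall>x\<in>DA. \<forall>y\<in>DA. A (x + y) = A x + A y) \<and>
     (\<forall>c. \<forall>x\<in>DA. A (c *\<^sub>R x) = c *\<^sub>R A x)"

definition matrix_blinfun :: "real ^ 'p ^ 'm \<Rightarrow> (real ^ 'p) \<Rightarrow>\<^sub>L (real ^ 'm)" where
  "matrix_blinfun K = Blinfun ((*v) K)"

lemma matrix_blinfun_apply [simp]: "blinfun_apply (matrix_blinfun K) y = K *v y"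
  by (simp add: matrix_blinfun_def bounded_linear_Blinfun_apply)

text \<open>
  Continuous differentiability relative to \<open>S\<close>: the derivative is one-sided at an endpoint
  belonging to \<open>S\<close>, unlike in \<open>C1_differentiable_on\<close>.
\<close>

definition C1_within :: "real set \<Rightarrow> (real \<Rightarrow> real) \<Rightarrow> bool" where
  "C1_within S f \<longleftrightarrow>
     (\<exists>f'. (\<forall>t\<in>S. (f has_real_derivative f' t) (at t within S)) \<and> continuous_on S f')"

definition solution ::
  "real \<Rightarrow> 'x::real_normed_vector set \<Rightarrow> ('x \<Rightarrow> 'x) \<Rightarrow> (real \<Rightarrow> real) \<Rightarrow> (real \<Rightarrow> real) \<Rightarrow>
     ('x \<Rightarrow>\<^sub>L 'x) \<Rightarrow> ('x \<Rightarrow>\<^sub>L 'x) \<Rightarrow> 'x \<Rightarrow> (real \<Rightarrow> 'x) \<Rightarrow> bool" where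
  "solution T DA A0 \<alpha> d D L z0 z \<longleftrightarrow>
     (AE t in lebesgue_on {0<..<T}. z t \<in> DA) \<and>
     L1 T (\<lambda>t. A0 (z t)) \<and>
     initial_value T z z0 \<and>
     (\<exists>z'. W11 T z z' \<and>
        (AE t in lebesgue_on {0<..<T}.
           z' t + d t *\<^sub>R A0 (z t) + (1 / \<alpha> t) *\<^sub>R blinfun_apply D (z t) + blinfun_apply L (z t) = 0))"

end

theory Submission
  imports Defs
begin

text \<open>
  If \<open>D z\<^sub>0 \<noteq> 0\<close> for some \<open>z\<^sub>0\<close> in the dense subspace, then \<open>\<parallel>D z(t)\<parallel>\<close> stays above some
  \<open>c > 0\<close> for small \<open>t\<close>, by continuity of \<open>z\<close> at \<open>0\<close>. The equation expresses \<open>(1 / \<alpha>) D z\<close>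
  through the integrable functions \<open>z'\<close>, \<open>d A\<^sub>0 z\<close> and \<open>L z\<close>, so \<open>1 / \<alpha>\<close> would be integrable near \<open>0\<close>.
  Hence \<open>D\<close> vanishes on a dense set.
\<close>

text \<open>
  Only the norm of \<open>f\<close> is replaced by a measurable function, as \<open>f\<close> itself need
  not be Borel measurable when its codomain is not separable.
\<close>

lemma strongly_integrable_norm_AE_measurable:
  assumes "strongly_integrable M f"
  obtains g where "g \<in> borel_measurable M" "AE x in M. ennreal (norm (f x)) = g x"
    "(\<integral>\<^sup>+x. g x \<partial>M) < \<infinity>"
proof -
  obtain s where s: "\<And>i::nat. simple_function M (s i)"
    and lim: "AE x in M. (\<lambda>i. s i x) \<longlonglongrightarrow> f x"
    using assms unfolding strongly_integrable_def strongly_measurable_def by blast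
  \<comment> \<open>The simple functions converge only almost everywhere. A liminf in the extended
    nonnegative reals exists at every point and is measurable, and it equals the limit where there
    is one.\<close>
  define g where "g x = liminf (\<lambda>i. ennreal (norm (s i x)))" for x
  have "(\<lambda>x. ennreal (norm (s i x))) \<in> borel_measurable M" for i
    by (rule borel_measurable_simple_function, rule simple_function_compose1[OF s])
  then have meas: "g \<in> borel_measurable M"
    unfolding g_def by (intro borel_measurable_liminf)
  have eq: "AE x in M. ennreal (norm (f x)) = g x"
    using lim
  proof eventually_elim
    case (elim x)
    then have "(\<lambda>i. ennreal (norm (s i x))) \<longlonglongrightarrow> ennreal (norm (f x))"
      by (intro tendsto_ennrealI tendsto_norm)
    then show ?case
      unfolding g_def by (metis lim_imp_Liminf trivial_limit_sequentially)
  qed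
  have "(\<integral>\<^sup>+x. g x \<partial>M) = (\<integral>\<^sup>+x. ennreal (norm (f x)) \<partial>M)"
    by (rule nn_integral_cong_AE) (use eq in auto)
  then have "(\<integral>\<^sup>+x. g x \<partial>M) < \<infinity>"
    using assms by (simp add: strongly_integrable_def)
  with meas eq show thesis by (rule that)
qed

text \<open>The part of the argument that concerns one trajectory: \<open>1 / \<alpha>\<close> is
  dominated near 0 by an integrable function built from the solution. The upper bound on
  \<open>d\<close> is what keeps \<open>d A0 z\<close> integrable.\<close>

lemma solution_imp_blinfun_initial_value_eq_0:
  fixes D L :: "'x::real_normed_vector \<Rightarrow>\<^sub>L 'x" and A0 :: "'x \<Rightarrow> 'x"
  assumes T: "T > 0"
    and \<alpha>_pos: "\<forall>t\<in>{0<..T}. \<alpha> t > 0"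
    and d_bounds: "\<forall>t\<in>{0<..T}. 0 \<le> d t \<and> d t \<le> d_plus"
    and \<alpha>_not_integrable:
      "\<forall>\<delta>\<in>{0<..T}. (\<integral>\<^sup>+t\<in>{0<..<\<delta>}. ennreal (1 / \<alpha> t) \<partial>lborel) = \<infinity>"
    and sol: "solution T DA A0 \<alpha> d D L z0 z"
  shows "blinfun_apply D z0 = 0"
proof (rule ccontr)
  assume nz: "blinfun_apply D z0 \<noteq> 0"
  let ?M = "lebesgue_on {0<..<T}"
  from sol obtain w z' where A0z: "L1 T (\<lambda>t. A0 (z t))"
    and w: "continuous_on {0..T} w" "AE t in ?M. w t = z t" "w 0 = z0"
    and W: "W11 T z z'"
    and eq: "AE t in ?M. z' t + d t *\<^sub>R A0 (z t) + (1 / \<alpha> t) *\<^sub>R blinfun_apply D (z t)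
      + blinfun_apply L (z t) = 0"
    unfolding solution_def initial_value_def by blast
  \<comment> \<open>Half the value at 0 lies strictly below the limit, so \<open>c\<close> survives
    as a lower bound near 0. The bound is obtained for the continuous representative
    \<open>w\<close> and carried over to \<open>z\<close> almost everywhere.\<close>
  define c where "c = norm (blinfun_apply D z0) / 2"
  have c: "c > 0" using nz by (simp add: c_def)
  have "continuous_on {0..T} (\<lambda>t. norm (blinfun_apply D (w t)))"
    using w(1) by (intro continuous_intros)
  then have "((\<lambda>t. norm (blinfun_apply D (w t))) \<longlongrightarrow> norm (blinfun_apply D (w 0))) (at 0 within {0..T})"
    using T by (simp add: continuous_on_def)
  then have "\<forall>\<^sub>F t in at 0 within {0..T}. norm (blinfun_apply D (w t)) > c"
    by (rule order_tendstoD) (use nz w(3) in \<open>simp add: c_def\<close>)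
  then obtain e where e: "e > 0"
    "\<And>t. t \<in> {0..T} \<Longrightarrow> t \<noteq> 0 \<Longrightarrow> dist t 0 < e \<Longrightarrow> norm (blinfun_apply D (w t)) > c"
    unfolding eventually_at by blast
  define \<delta> where "\<delta> = min e T"
  have \<delta>: "\<delta> \<in> {0<..T}" using e(1) T by (simp add: \<delta>_def)
  have low: "norm (blinfun_apply D (w t)) > c" if "t \<in> {0<..<\<delta>}" for t
    using that by (intro e(2)) (auto simp: \<delta>_def)
  have "L1 T z'" "L1 T z" using W by (auto simp: W11_def)
  \<comment> \<open>Measurable versions of the three norms, so that the integral of their weighted
    sum can be split later.\<close>
  obtain g1 where g1: "g1 \<in> borel_measurable ?M"
    "AE x in ?M. ennreal (norm (z' x)) = g1 x" "(\<integral>\<^sup>+x. g1 x \<partial>?M) < \<infinity>"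
    using strongly_integrable_norm_AE_measurable[OF \<open>L1 T z'\<close>[unfolded L1_def]] .
  obtain g2 where g2: "g2 \<in> borel_measurable ?M"
    "AE x in ?M. ennreal (norm (A0 (z x))) = g2 x" "(\<integral>\<^sup>+x. g2 x \<partial>?M) < \<infinity>"
    using strongly_integrable_norm_AE_measurable[OF A0z[unfolded L1_def]] .
  obtain g3 where g3: "g3 \<in> borel_measurable ?M"
    "AE x in ?M. ennreal (norm (z x)) = g3 x" "(\<integral>\<^sup>+x. g3 x \<partial>?M) < \<infinity>"
    using strongly_integrable_norm_AE_measurable[OF \<open>L1 T z\<close>[unfolded L1_def]] .
  have [measurable]: "g1 \<in> borel_measurable ?M" "g2 \<in> borel_measurable ?M" "g3 \<in> borel_measurable ?M"
    by fact+
  let ?g = "\<lambda>t. g1 t + (ennreal d_plus * g2 t + ennreal (norm L) * g3 t)"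
  let ?h = "\<lambda>t. ennreal (1 / \<alpha> t) * indicator {0<..<\<delta>} t"
  have bound: "AE t in ?M. ?h t \<le> ennreal (1 / c) * ?g t"
    using w(2) eq g1(2) g2(2) g3(2) AE_space
  proof eventually_elim
    case (elim t)
    show ?case
    proof (cases "t \<in> {0<..<\<delta>}")
      case True
      then have t: "t \<in> {0<..T}" using \<delta> by auto
      have \<alpha>: "\<alpha> t > 0" using \<alpha>_pos t by blast
      have dt: "0 \<le> d t" "d t \<le> d_plus" using d_bounds t by auto
      \<comment> \<open>Isolate the singular term; the norms of the others have integrable
        bounds.\<close>
      have "(1 / \<alpha> t) *\<^sub>R blinfun_apply D (z t) = - (z' t + (d t *\<^sub>R A0 (z t) + blinfun_apply L (z t)))"
        using elim(2) by (simp only: eq_neg_iff_add_eq_0 add_ac)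
      then have "1 / \<alpha> t * norm (blinfun_apply D (z t))
          = norm (z' t + (d t *\<^sub>R A0 (z t) + blinfun_apply L (z t)))"
        using \<alpha> by (metis abs_of_pos norm_minus_cancel norm_scaleR zero_less_divide_1_iff)
      also have "\<dots> \<le> norm (z' t) + (norm (d t *\<^sub>R A0 (z t)) + norm (blinfun_apply L (z t)))"
        by (intro norm_triangle_le add_left_mono norm_triangle_ineq)
      also have "\<dots> \<le> norm (z' t) + (d_plus * norm (A0 (z t)) + norm L * norm (z t))"
        using dt by (intro add_mono order_refl norm_blinfun) (auto intro: mult_right_mono)
      finally have up: "1 / \<alpha> t * norm (blinfun_apply D (z t)) \<le> \<dots>" .
      have "1 / \<alpha> t * c \<le> 1 / \<alpha> t * norm (blinfun_apply D (z t))"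
        using low[OF True] elim(1) \<alpha> by (intro mult_left_mono) auto
      with up have "1 / \<alpha> t \<le> 1 / c * (norm (z' t) + (d_plus * norm (A0 (z t)) + norm L * norm (z t)))"
        using c by (simp add: field_simps)
      then have "ennreal (1 / \<alpha> t)
          \<le> ennreal (1 / c * (norm (z' t) + (d_plus * norm (A0 (z t)) + norm L * norm (z t))))"
        by (rule ennreal_leI)
      \<comment> \<open>The bounds \<open>dt\<close> force \<open>d_plus \<ge> 0\<close>, so
        \<open>ennreal\<close> respects these sums and products.\<close>
      also have "\<dots> = ennreal (1 / c) * ?g t"
        using c dt unfolding elim(3-5)[symmetric]
        by (subst ennreal_mult; simp add: ennreal_mult ennreal_plus)
      finally show ?thesis using True by simp
    qed simp
  qed
  \<comment> \<open>Passing to \<open>?M\<close> loses nothing: completion preserves the integral,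
    and \<open>?h\<close> vanishes outside (0, \<delta>), which lies in (0, T).\<close>
  have "(\<integral>\<^sup>+t. ?h t \<partial>lborel) = (\<integral>\<^sup>+t. ?h t \<partial>lebesgue)"
    by (simp add: nn_integral_completion)
  also have "\<dots> = (\<integral>\<^sup>+t. ?h t * indicator {0<..<T} t \<partial>lebesgue)"
    using \<delta> by (intro nn_integral_cong) (auto split: split_indicator)
  also have "\<dots> = (\<integral>\<^sup>+t. ?h t \<partial>?M)"
    by (subst nn_integral_restrict_space) auto
  also have "\<dots> \<le> (\<integral>\<^sup>+t. ennreal (1 / c) * ?g t \<partial>?M)"
    by (rule nn_integral_mono_AE[OF bound])
  also have "\<dots> = ennreal (1 / c) * ((\<integral>\<^sup>+t. g1 t \<partial>?M)
      + (ennreal d_plus * (\<integral>\<^sup>+t. g2 t \<partial>?M) + ennreal (norm L) * (\<integral>\<^sup>+t. g3 t \<partial>?M)))"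
    by (simp add: nn_integral_cmult nn_integral_add)
  also have "\<dots> < \<infinity>"
    using g1(3) g2(3) g3(3) by (simp add: ennreal_mult_less_top)
  finally show False
    using \<alpha>_not_integrable \<delta> by (metis less_irrefl)
qed

theorem theorem1:
  fixes T d_minus d_plus :: real
    and DA :: "'x::{real_inner, banach} set" and A0 :: "'x \<Rightarrow> 'x"
    and A1 Ar D L :: "'x \<Rightarrow>\<^sub>L 'x"
    and B :: "(real ^ 'm) \<Rightarrow>\<^sub>L 'x" and C :: "'x \<Rightarrow>\<^sub>L (real ^ 'p)"
    and K0 K1 :: "real ^ 'p ^ 'm"
    and \<alpha> \<beta> d :: "real \<Rightarrow> real"
    and Dense :: "'x set"
  assumes T: "T > 0"
    and A0: "linear_operator DA A0"
    and D: "D = A1 - (B o\<^sub>L matrix_blinfun K0 o\<^sub>L C)"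
    and L: "L = Ar - (B o\<^sub>L matrix_blinfun K1 o\<^sub>L C)"
    and \<alpha>_cont: "continuous_on {0..T} \<alpha>"
    and \<alpha>_C1: "C1_within {0<..T} \<alpha>"
    and \<beta>_C1: "C1_within {0<..T} \<beta>"
    and \<alpha>_pos: "\<forall>t\<in>{0<..T}. \<alpha> t > 0"
    and \<beta>_pos: "\<forall>t\<in>{0<..T}. \<beta> t > 0"
    and \<alpha>_0: "\<alpha> 0 = 0"
    and d: "d = (\<lambda>t. \<beta> t / \<alpha> t)"
    and d_minus: "0 < d_minus" and d_minus_plus: "d_minus \<le> d_plus"
    and d_bounds: "\<forall>t\<in>{0<..T}. d_minus \<le> d t \<and> d t \<le> d_plus"
    and \<alpha>_not_integrable:
      "\<forall>\<delta>\<in>{0<..T}. (\<integral>\<^sup>+t\<in>{0<..<\<delta>}. ennreal (1 / \<alpha> t) \<partial>lborel) = \<infinity>"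
    and Dense: "subspace Dense" "closure Dense = UNIV"
    and sol: "\<forall>z0\<in>Dense. \<exists>z. solution T DA A0 \<alpha> d D L z0 z"
  shows "D = 0 \<and> A1 = B o\<^sub>L matrix_blinfun K0 o\<^sub>L C"
proof -
  have "blinfun_apply D z0 = 0" if z0: "z0 \<in> Dense" for z0
  proof -
    obtain z where "solution T DA A0 \<alpha> d D L z0 z" using sol z0 by blast
    moreover have "\<forall>t\<in>{0<..T}. 0 \<le> d t \<and> d t \<le> d_plus"
      using d_bounds d_minus by (meson less_imp_le order_trans)
    ultimately show ?thesis
      using solution_imp_blinfun_initial_value_eq_0[OF T \<alpha>_pos _ \<alpha>_not_integrable] by blast
  qed
  \<comment> \<open>The kernel of the bounded operator \<open>D\<close> is closed, so it contains
    the closure of any set on which \<open>D\<close> vanishes.\<close>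
  then have "closure Dense \<subseteq> {x. blinfun_apply D x = 0}"
    by (intro closure_minimal closed_Collect_eq continuous_intros) auto
  then have "D = 0"
    using Dense(2) by (intro blinfun_eqI) auto
  then show ?thesis using D by simp
qed

end
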